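(* Let $P\in\mathbb{P}_m(\mathbb{C}^{n\times n})$ be a regular $H$-even polynomial and let $(\lambda,x)\in\mathbb{C}\times\mathbb{C}^n$ be such that $\|x\|_2=1$ and $P(\lambda)x\ne0$. Let $\mathbb{S}$ be one of the two structures $H$-even or $H$-odd, and let $L\in\mathbb{L}_1(P)$ be a linearization of $P$ having the structure $\mathbb{S}$, with normalized right ansatz vector $v$ ($\|v\|_2=1$). Let $\Lambda_{m-1}:=[\lambda^{m-1},\ldots,\lambda,1]^T$. If $\lambda\in i\mathbb{R}$ then $$\sqrt{\frac{m+1}{2m}}\le\frac{\eta_F^{\mathbb{S}}(\lambda,\Lambda_{m-1}\otimes x,L;v)}{\eta_F^{H\text{-even}}(\lambda,x,P)}\le\sqrt2\quad\text{and}\quad\sqrt{\frac{m+1}{2m}}\le\frac{\eta_2^{\mathbb{S}}(\lambda,\Lambda_{m-1}\otimes x,L;v)}{\eta_2^{H\text{-even}}(\lambda,x,P)}\le1.$$ The same bounds hold when $P$ is $H$-odd (with $\eta_M^{H\text{-even}}(\lambda,x,P)$ replaced by $\eta_M^{H\text{-odd}}(\lambda,x,P)$, $M\in\{2,F\}$).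
   Context: $m,n\ge1$ are integers. $\mathbb{P}_k(\mathbb{C}^{N\times N})$ is the vector space of matrix polynomials $Q(z)=\sum_{j=0}^k z^jA_j$, $A_j\in\mathbb{C}^{N\times N}$. $Q$ is regular if $\det Q(z)\not\equiv0$; $H$-even if $A_j$ is Hermitian for even $j$ (including $0$) and skew-Hermitian for odd $j$; $H$-odd if $A_j$ is skew-Hermitian for even $j$ and Hermitian for odd $j$; the superscripts $H$-even, $H$-odd denote the corresponding sets. $i\mathbb{R}$ is the imaginary axis. For $M\in\{2,F\}$, $|||Q|||_M:=\left(\sum_{j=0}^k\|A_j\|_M^2\right)^{1/2}$ with $\|\cdot\|_F$ Frobenius and $\|\cdot\|_2$ spectral norm. For $\lambda\in\mathbb{C}$, $u\in\mathbb{C}^N\setminus\{0\}$, a structure class $\mathbb{S}\subset\mathbb{P}_k(\mathbb{C}^{N\times N})$ and regular $Q\in\mathbb{S}$, $\eta_M^{\mathbb{S}}(\lambda,u,Q):=\inf\{|||\Delta Q|||_M:\Delta Q\in\mathbb{S},\ Q(\lambda)u+\Delta Q(\lambda)u=0\}$. $\mathbb{L}_1(P)$ is the set of pencils $L(z)=zX+Y$, $X,Y\in\mathbb{C}^{mn\times mn}$, for which there is $v\in\mathbb{C}^m$ (the right ansatz vector of $L$) with $L(z)\,([z^{m-1},z^{m-2},\ldots,1]^T\otimes I_n)=v\otimes P(z)$ for all $z$; $\otimes$ is the Kronecker product. $L$ is a linearization of $P$ if there are unimodular matrix polynomials $E,F$ with $E(z)L(z)F(z)=\mathrm{diag}(P(z),I_{(m-1)n})$.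 The pencil $L$ is viewed as an element of $\mathbb{P}_1(\mathbb{C}^{mn\times mn})$ and its structured backward errors are taken over all pencils of structure $\mathbb{S}$ in that space; the $v$ in $\eta_M^{\mathbb{S}}(\lambda,\cdot,L;v)$ only records the ansatz vector. *)

theory Defs
  imports "Jordan_Normal_Form.Schur_Decomposition"
begin

section \<open>Matrix polynomials\<close>

text \<open>
  A matrix polynomial is a matrix with polynomial entries. The space \<open>mat_polys k N\<close> of
  \<open>N \<times> N\<close> matrix polynomials of grade \<open>k\<close> contains those whose entries have degree at most
  \<open>k\<close>; the leading coefficient may vanish.
\<close>

type_synonym mat_poly = "complex poly mat"

definition mat_polys :: "nat \<Rightarrow> nat \<Rightarrow> mat_poly set" where
  "mat_polys k N = {Q \<in> carrier_mat N N. \<forall>i<N. \<forall>j<N. degree (Q $$ (i, j)) \<le> k}"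

definition mp_coeff :: "mat_poly \<Rightarrow> nat \<Rightarrow> complex mat" where
  "mp_coeff Q j = map_mat (\<lambda>p. coeff p j) Q"

definition mp_eval :: "mat_poly \<Rightarrow> complex \<Rightarrow> complex mat" where
  "mp_eval Q z = map_mat (\<lambda>p. poly p z) Q"

definition regular :: "mat_poly \<Rightarrow> bool" where
  "regular Q \<longleftrightarrow> det Q \<noteq> 0"

definition hermitian :: "complex mat \<Rightarrow> bool" where
  "hermitian A \<longleftrightarrow> mat_adjoint A = A"

definition skew_hermitian :: "complex mat \<Rightarrow> bool" where
  "skew_hermitian A \<longleftrightarrow> mat_adjoint A = - A"

definition H_even :: "nat \<Rightarrow> nat \<Rightarrow> mat_poly set" where
  "H_even k N = {Q \<in> mat_polys k N. \<forall>j\<le>k.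
     (even j \<longrightarrow> hermitian (mp_coeff Q j)) \<and> (odd j \<longrightarrow> skew_hermitian (mp_coeff Q j))}"

definition H_odd :: "nat \<Rightarrow> nat \<Rightarrow> mat_poly set" where
  "H_odd k N = {Q \<in> mat_polys k N. \<forall>j\<le>k.
     (even j \<longrightarrow> skew_hermitian (mp_coeff Q j)) \<and> (odd j \<longrightarrow> hermitian (mp_coeff Q j))}"


section \<open>Norms and backward errors\<close>

definition norm2 :: "complex vec \<Rightarrow> real" where
  "norm2 v = sqrt (\<Sum>i<dim_vec v. (cmod (v $ i))\<^sup>2)"

definition frobenius_norm :: "complex mat \<Rightarrow> real" where
  "frobenius_norm A = sqrt (\<Sum>i<dim_row A. \<Sum>j<dim_col A. (cmod (A $$ (i, j)))\<^sup>2)"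

definition spectral_norm :: "complex mat \<Rightarrow> real" where
  "spectral_norm A = Sup {norm2 (A *\<^sub>v w) | w. w \<in> carrier_vec (dim_col A) \<and> norm2 w = 1}"

definition mp_norm :: "(complex mat \<Rightarrow> real) \<Rightarrow> nat \<Rightarrow> mat_poly \<Rightarrow> real" where
  "mp_norm \<mu> k Q = sqrt (\<Sum>j\<le>k. (\<mu> (mp_coeff Q j))\<^sup>2)"

text \<open>
  The structured backward error \<open>\<eta>\<^sub>M\<^sup>S(lam, u, Q)\<close> for the matrix norm \<open>\<mu>\<close> and a class \<open>S\<close>
  of matrix polynomials of grade \<open>k\<close>. It is used for regular \<open>Q \<in> S\<close>, where the set of
  admissible perturbations contains \<open>- Q\<close> and the infimum is that of a nonempty set bounded
  below by zero.
\<close>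

definition backward_error ::
  "(complex mat \<Rightarrow> real) \<Rightarrow> nat \<Rightarrow> mat_poly set \<Rightarrow> complex \<Rightarrow> complex vec \<Rightarrow> mat_poly \<Rightarrow> real" where
  "backward_error \<mu> k S lam u Q =
     Inf {mp_norm \<mu> k \<Delta>Q | \<Delta>Q. \<Delta>Q \<in> S \<and>
            mp_eval Q lam *\<^sub>v u + mp_eval \<Delta>Q lam *\<^sub>v u = 0\<^sub>v (dim_row Q)}"


section \<open>The ansatz space and linearizations\<close>

definition kron :: "'a::semiring_0 mat \<Rightarrow> 'a mat \<Rightarrow> 'a mat" where
  "kron A B = mat (dim_row A * dim_row B) (dim_col A * dim_col B)
     (\<lambda>(i, j). A $$ (i div dim_row B, j div dim_col B) * B $$ (i mod dim_row B, j mod dim_col B))"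

definition col_mat :: "'a vec \<Rightarrow> 'a mat" where
  "col_mat u = mat_of_cols (dim_vec u) [u]"

definition kron_vec :: "'a::semiring_0 vec \<Rightarrow> 'a vec \<Rightarrow> 'a vec" where
  "kron_vec u w = col (kron (col_mat u) (col_mat w)) 0"

text \<open>\<open>Lam m z\<close> is the vector \<open>[z\<^bsup>m-1\<^esup>, \<dots>, z, 1]\<^sup>T\<close> of length \<open>m\<close>.\<close>

definition Lam :: "nat \<Rightarrow> complex \<Rightarrow> complex vec" where
  "Lam m z = vec m (\<lambda>i. z ^ (m - 1 - i))"

definition right_ansatz_vector ::
  "nat \<Rightarrow> nat \<Rightarrow> mat_poly \<Rightarrow> mat_poly \<Rightarrow> complex vec \<Rightarrow> bool" where
  "right_ansatz_vector m n P L v \<longleftrightarrow> v \<in> carrier_vec m \<and>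
     (\<forall>z. mp_eval L z * kron (col_mat (Lam m z)) (1\<^sub>m n) = kron (col_mat v) (mp_eval P z))"

definition L1_space :: "nat \<Rightarrow> nat \<Rightarrow> mat_poly \<Rightarrow> mat_poly set" where
  "L1_space m n P = {L \<in> mat_polys 1 (m * n). \<exists>v. right_ansatz_vector m n P L v}"

definition unimodular :: "mat_poly \<Rightarrow> bool" where
  "unimodular E \<longleftrightarrow> (\<exists>c. c \<noteq> 0 \<and> det E = [:c:])"

definition linearization :: "nat \<Rightarrow> nat \<Rightarrow> mat_poly \<Rightarrow> mat_poly \<Rightarrow> bool" where
  "linearization m n P L \<longleftrightarrow>
     (\<exists>E \<in> carrier_mat (m * n) (m * n). \<exists>F \<in> carrier_mat (m * n) (m * n).
        unimodular E \<and> unimodular F \<and>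
        E * L * F = four_block_mat P (0\<^sub>m n ((m - 1) * n)) (0\<^sub>m ((m - 1) * n) n) (1\<^sub>m ((m - 1) * n)))"

end

theory Submission
  imports Defs "HOL-Analysis.L2_Norm"
begin

text \<open>
  For \<open>lam\<close> on the imaginary axis, \<open>\<Delta>Q(lam)\<close> is Hermitian up to a fixed phase, so the backward
  error is the least norm of a Hermitian matrix \<open>E\<close> with prescribed \<open>E u = r\<close>, divided by
  \<open>l k = \<parallel>(1, lam, \<dots>, lam\<^sup>k)\<parallel>\<close>. With \<open>u\<close> normalized, this least norm is \<open>\<parallel>r\<parallel>\<close> for the spectral norm
  and \<open>sqrt (2 \<parallel>r\<parallel>\<^sup>2 - |u\<^sup>* r|\<^sup>2)\<close> for the Frobenius norm. The ansatz equation gives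
  \<open>L(lam) (\<Lambda> \<otimes> x) = v \<otimes> P(lam) x\<close>, so the spectral ratio is \<open>l m / (l (m - 1) * l 1)\<close>. The
  Frobenius ratio has an additional factor, which lies between \<open>1\<close> and \<open>sqrt 2\<close> because
  \<open>|\<Lambda>\<^sup>* v| \<le> \<parallel>\<Lambda>\<parallel>\<close>.
\<close>

section \<open>Euclidean vectors and Hermitian matrices\<close>

lemma cscalar_prod_sum: "v \<bullet>c w = (\<Sum>i<dim_vec w. v $ i * cnj (w $ i))" for v w :: "complex vec"
  by (simp add: scalar_prod_def lessThan_atLeast0)

lemma norm2_L2_set: "norm2 v = L2_set (\<lambda>i. cmod (v $ i)) {..<dim_vec v}"
  by (simp add: norm2_def L2_set_def)

lemma norm2_nonneg: "0 \<le> norm2 v"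
  by (simp add: norm2_L2_set)

lemma norm2_squared: "(norm2 v)\<^sup>2 = (\<Sum>i<dim_vec v. (cmod (v $ i))\<^sup>2)"
  by (simp add: norm2_def sum_nonneg)

lemma cscalar_prod_self: "v \<bullet>c v = complex_of_real ((norm2 v)\<^sup>2)"
  by (simp add: norm2_squared cscalar_prod_sum complex_norm_square del: of_real_power)

lemma norm2_smult: "norm2 (a \<cdot>\<^sub>v w) = cmod a * norm2 w"
  by (simp add: norm2_L2_set L2_set_right_distrib norm_mult cong: L2_set_cong_simp)

lemma norm2_add:
  assumes "v \<in> carrier_vec N" "w \<in> carrier_vec N"
  shows "norm2 (v + w) \<le> norm2 v + norm2 w"
proof -
  have "norm2 (v + w) \<le> L2_set (\<lambda>i. cmod (v $ i) + cmod (w $ i)) {..<N}"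
    using assms by (auto simp: norm2_L2_set intro!: L2_set_mono norm_triangle_ineq)
  also have "\<dots> \<le> norm2 v + norm2 w"
    using assms L2_set_triangle_ineq[of "\<lambda>i. cmod (v $ i)" "\<lambda>i. cmod (w $ i)" "{..<N}"]
    by (auto simp: norm2_L2_set)
  finally show ?thesis .
qed

lemma norm2_eq_0_iff:
  assumes "v \<in> carrier_vec N"
  shows "norm2 v = 0 \<longleftrightarrow> v = 0\<^sub>v N"
  using assms by (auto simp: norm2_L2_set L2_set_eq_0_iff)

lemma cscalar_prod_swap: "dim_vec v = dim_vec w \<Longrightarrow> cnj (v \<bullet>c w) = w \<bullet>c v" for v w :: "complex vec"
  by (simp add: cscalar_prod_sum mult.commute)

lemma cscalar_prod_Cauchy_Schwarz:
  assumes "dim_vec v = dim_vec w"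
  shows "cmod (v \<bullet>c w) \<le> norm2 v * norm2 w"
proof -
  have "cmod (v \<bullet>c w) \<le> (\<Sum>i<dim_vec w. \<bar>cmod (v $ i)\<bar> * \<bar>cmod (w $ i)\<bar>)"
    unfolding cscalar_prod_sum by (rule order_trans[OF norm_sum]) (simp add: norm_mult)
  also have "\<dots> \<le> norm2 v * norm2 w"
    unfolding norm2_L2_set assms by (rule L2_set_mult_ineq)
  finally show ?thesis .
qed

text \<open>This is the Householder reflection along \<open>w\<close>; in the expansion of the
  squared norm the cross terms cancel the last term. For \<open>w = 0\<close> the quotient is
  \<open>0\<close> by the convention on division, and the map is the identity.\<close>

lemma norm2_reflection:
  assumes "z \<in> carrier_vec N" "w \<in> carrier_vec N"
  shows "norm2 (z - (2 * (z \<bullet>c w) / (w \<bullet>c w)) \<cdot>\<^sub>v w) = norm2 z"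
proof -
  define p q where "p = z \<bullet>c w" and "q = (norm2 w)\<^sup>2"
  define k where "k = 2 * p / complex_of_real q"
  have k: "2 * (z \<bullet>c w) / (w \<bullet>c w) = k"
    by (simp add: k_def p_def q_def cscalar_prod_self)
  have wz: "w \<bullet>c z = cnj p"
    using assms by (simp add: p_def cscalar_prod_swap)
  let ?y = "z - k \<cdot>\<^sub>v w"
  have "?y \<bullet>c ?y = z \<bullet>c z - cnj k * (z \<bullet>c w) - k * (w \<bullet>c z) + k * cnj k * (w \<bullet>c w)"
    using assms unfolding cscalar_prod_sum
    by (simp add: algebra_simps sum.distrib sum_subtractf sum_distrib_left)
  also have "\<dots> = z \<bullet>c z"
    unfolding wz p_def[symmetric] cscalar_prod_self[of w] q_def[symmetric]
    by (cases "q = 0") (simp_all add: k_def)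
  finally have "(norm2 ?y)\<^sup>2 = (norm2 z)\<^sup>2"
    unfolding cscalar_prod_self of_real_eq_iff .
  then show ?thesis
    by (simp add: k norm2_nonneg)
qed

section \<open>Hermitian and skew-Hermitian matrices up to a phase\<close>

lemma hermitian_iff:
  assumes "A \<in> carrier_mat N N"
  shows "hermitian A \<longleftrightarrow> (\<forall>i<N. \<forall>j<N. cnj (A $$ (j, i)) = A $$ (i, j))"
proof -
  have "mat_adjoint A \<in> carrier_mat N N" "\<And>i j. i < N \<Longrightarrow> j < N \<Longrightarrow> mat_adjoint A $$ (i, j) = cnj (A $$ (j, i))"
    using assms by (auto simp: mat_adjoint_def mat_of_rows_def)
  then show ?thesis
    using assms unfolding hermitian_def by (auto simp: mat_eq_iff)
qed

text \<open>Conjugation sends \<open>\<i>\<close> to its negative, so the factor \<open>\<i>\<close>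
  absorbs the sign. This leaves Hermitian matrices as the only kind to be treated.\<close>

lemma skew_hermitian_iff:
  assumes "A \<in> carrier_mat N N"
  shows "skew_hermitian A \<longleftrightarrow> hermitian (\<i> \<cdot>\<^sub>m A)"
proof -
  have *: "mat_adjoint A \<in> carrier_mat N N" "\<And>i j. i < N \<Longrightarrow> j < N \<Longrightarrow> mat_adjoint A $$ (i, j) = cnj (A $$ (j, i))"
    using assms by (auto simp: mat_adjoint_def mat_of_rows_def)
  have "skew_hermitian A \<longleftrightarrow> (\<forall>i<N. \<forall>j<N. cnj (A $$ (j, i)) = - A $$ (i, j))"
  proof -
    have "mat_adjoint A = - A \<longleftrightarrow> (\<forall>i<N. \<forall>j<N. mat_adjoint A $$ (i, j) = (- A) $$ (i, j))"
      using assms carrier_matD[OF *(1)] by (simp only: mat_eq_iff index_uminus_mat carrier_matD) simp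
    then show ?thesis
      using assms by (simp add: skew_hermitian_def *(2) cong: all_cong)
  qed
  also have "\<dots> \<longleftrightarrow> (\<forall>i<N. \<forall>j<N. cnj (\<i> * A $$ (j, i)) = \<i> * A $$ (i, j))"
  proof -
    have "cnj a = - b \<longleftrightarrow> cnj (\<i> * a) = \<i> * b" for a b
      by (auto simp: complex_eq_iff)
    then show ?thesis
      by simp
  qed
  also have "\<dots> \<longleftrightarrow> hermitian (\<i> \<cdot>\<^sub>m A)"
    using assms by (subst hermitian_iff[of _ N]) auto
  finally show ?thesis .
qed

lemma hermitian_smult_real:
  assumes "hermitian A" "A \<in> carrier_mat N N" "Im a = 0"
  shows "hermitian (a \<cdot>\<^sub>m A)"
proof -
  have "cnj a = a"
    using assms by (simp add: complex_eq_iff)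
  then show ?thesis
    using assms by (simp add: hermitian_iff[of _ N])
qed

lemma hermitian_smult_real_iff:
  assumes "A \<in> carrier_mat N N" "Im a = 0" "a \<noteq> 0"
  shows "hermitian (a \<cdot>\<^sub>m A) \<longleftrightarrow> hermitian A"
proof
  assume *: "hermitian (a \<cdot>\<^sub>m A)"
  have "cnj a = a"
    using assms by (simp add: complex_eq_iff)
  then have "Im (inverse a) = 0"
    by (metis Reals_cnj_iff Reals_inverse complex_is_Real_iff)
  then have "hermitian (inverse a \<cdot>\<^sub>m (a \<cdot>\<^sub>m A))"
    using assms by (intro hermitian_smult_real[OF *, of N]) auto
  moreover have "inverse a \<cdot>\<^sub>m (a \<cdot>\<^sub>m A) = A"
    using assms by (auto simp: mat_eq_iff)
  ultimately show "hermitian A" by simp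
next
  assume "hermitian A"
  then show "hermitian (a \<cdot>\<^sub>m A)"
    using assms by (intro hermitian_smult_real)
qed

text \<open>Multiplying the \<open>j\<close>-th coefficient by \<open>c * \<i>\<^sup>j\<close> treats both structures at once: \<open>c = 1\<close> for
  H-even, \<open>c = \<i>\<close> for H-odd.\<close>

definition phase_class :: "complex \<Rightarrow> nat \<Rightarrow> nat \<Rightarrow> mat_poly set" where
  "phase_class c k N = {Q \<in> mat_polys k N. \<forall>j\<le>k. hermitian ((c * \<i> ^ j) \<cdot>\<^sub>m mp_coeff Q j)}"

lemma mp_coeff_carrier: "Q \<in> mat_polys k N \<Longrightarrow> mp_coeff Q j \<in> carrier_mat N N"
  by (auto simp: mat_polys_def mp_coeff_def)

text \<open>Even powers of \<open>\<i>\<close> are 1 or -1, and a nonzero real factor does not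
  affect being Hermitian. Only the parity of the exponent matters: a remaining factor
  \<open>\<i>\<close> exchanges Hermitian and skew-Hermitian.\<close>

lemma hermitian_phase:
  assumes "A \<in> carrier_mat N N"
  shows "hermitian (\<i> ^ j \<cdot>\<^sub>m A) \<longleftrightarrow> (if even j then hermitian A else skew_hermitian A)"
    and "hermitian ((\<i> * \<i> ^ j) \<cdot>\<^sub>m A) \<longleftrightarrow> (if even j then skew_hermitian A else hermitian A)"
proof -
  have r: "Im (\<i> ^ (2 * l)) = 0" "Im (- (\<i> ^ (2 * l))) = 0" "\<i> ^ (2 * l) \<noteq> 0" for l
    by (simp_all add: power_mult)
  have s: "(\<i> ^ (2 * l) * \<i>) \<cdot>\<^sub>m A = \<i> ^ (2 * l) \<cdot>\<^sub>m (\<i> \<cdot>\<^sub>m A)" for l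
    by (auto simp: mat_eq_iff)
  have iA: "\<i> \<cdot>\<^sub>m A \<in> carrier_mat N N"
    using assms by simp
  show "hermitian (\<i> ^ j \<cdot>\<^sub>m A) \<longleftrightarrow> (if even j then hermitian A else skew_hermitian A)"
  proof (cases "even j")
    case True
    then obtain l where "j = 2 * l" by blast
    then show ?thesis
      using True hermitian_smult_real_iff[OF assms r(1,3)] by simp
  next
    case False
    then obtain l where l: "j = 2 * l + 1" by (elim oddE)
    have "\<i> ^ j \<cdot>\<^sub>m A = \<i> ^ (2 * l) \<cdot>\<^sub>m (\<i> \<cdot>\<^sub>m A)"
      unfolding s[symmetric] l by (simp add: mult.commute)
    then show ?thesis
      using False hermitian_smult_real_iff[OF iA r(1,3)] skew_hermitian_iff[OF assms] by simp
  qed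
  show "hermitian ((\<i> * \<i> ^ j) \<cdot>\<^sub>m A) \<longleftrightarrow> (if even j then skew_hermitian A else hermitian A)"
  proof (cases "even j")
    case True
    then obtain l where "j = 2 * l" by blast
    then show ?thesis
      using True s[of l] hermitian_smult_real_iff[OF iA r(1,3)] skew_hermitian_iff[OF assms]
      by (simp add: mult.commute)
  next
    case False
    then obtain l where l: "j = 2 * l + 1" by (elim oddE)
    have "\<i> * \<i> ^ j = - (\<i> ^ (2 * l))"
      unfolding l by simp
    then show ?thesis
      using False hermitian_smult_real_iff[OF assms r(2)] r(3) by simp
  qed
qed

lemma H_even_phase_class: "H_even k N = phase_class 1 k N"
proof -
  have "hermitian ((1 * \<i> ^ j) \<cdot>\<^sub>m mp_coeff Q j) \<longleftrightarrow>
      (even j \<longrightarrow> hermitian (mp_coeff Q j)) \<and> (odd j \<longrightarrow> skew_hermitian (mp_coeff Q j))"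
    if "Q \<in> mat_polys k N" for Q j
    using hermitian_phase(1)[OF mp_coeff_carrier[OF that], of j j] by simp
  then show ?thesis
    unfolding H_even_def phase_class_def
    by (intro Collect_cong conj_cong refl all_cong) (simp only:)
qed

lemma H_odd_phase_class: "H_odd k N = phase_class \<i> k N"
proof -
  have "hermitian ((\<i> * \<i> ^ j) \<cdot>\<^sub>m mp_coeff Q j) \<longleftrightarrow>
      (even j \<longrightarrow> skew_hermitian (mp_coeff Q j)) \<and> (odd j \<longrightarrow> hermitian (mp_coeff Q j))"
    if "Q \<in> mat_polys k N" for Q j
    using hermitian_phase(2)[OF mp_coeff_carrier[OF that], of j j] by simp
  then show ?thesis
    unfolding H_odd_def phase_class_def
    by (intro Collect_cong conj_cong refl all_cong) (simp only:)
qed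

section \<open>Matrix norms\<close>

text \<open>The properties shared by the Frobenius and the spectral norm on which the reduction of a
  backward error to a single Hermitian matrix rests.\<close>

locale matrix_seminorm =
  fixes \<mu> :: "complex mat \<Rightarrow> real" and N :: nat
  assumes nonneg: "A \<in> carrier_mat N N \<Longrightarrow> 0 \<le> \<mu> A"
    and triangle: "A \<in> carrier_mat N N \<Longrightarrow> B \<in> carrier_mat N N \<Longrightarrow> \<mu> (A + B) \<le> \<mu> A + \<mu> B"
    and smult_le: "A \<in> carrier_mat N N \<Longrightarrow> \<mu> (a \<cdot>\<^sub>m A) \<le> cmod a * \<mu> A"
begin

text \<open>Meant for the value of a matrix polynomial at a point, with \<open>f j\<close> a
  multiple of the \<open>j\<close>-th power. The entrywise form of the sum agrees with the one in
  which evaluation is expanded later.\<close>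

lemma lincomb_le:
  fixes k :: nat
  assumes "\<And>j. A j \<in> carrier_mat N N"
  shows "\<mu> (mat N N (\<lambda>p. \<Sum>j\<le>k. f j * A j $$ p)) \<le> (\<Sum>j\<le>k. cmod (f j) * \<mu> (A j))"
proof (induction k)
  case 0
  have eq: "mat N N (\<lambda>p. \<Sum>j\<le>0. f j * A j $$ p) = f 0 \<cdot>\<^sub>m A 0"
    using assms[of 0] by (intro eq_matI) auto
  show ?case
    unfolding eq using smult_le[OF assms, of "f 0" 0] by simp
next
  case (Suc k)
  let ?M = "\<lambda>k. mat N N (\<lambda>p. \<Sum>j\<le>k. f j * A j $$ p)"
  have "?M (Suc k) = ?M k + f (Suc k) \<cdot>\<^sub>m A (Suc k)"
    using assms[of "Suc k"] by (intro eq_matI) auto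
  then have "\<mu> (?M (Suc k)) \<le> \<mu> (?M k) + \<mu> (f (Suc k) \<cdot>\<^sub>m A (Suc k))"
    using assms by (simp add: triangle)
  also have "\<dots> \<le> (\<Sum>j\<le>Suc k. cmod (f j) * \<mu> (A j))"
    using Suc smult_le[OF assms] by (simp add: add_mono)
  finally show ?case .
qed

end

lemma frobenius_norm_L2_set:
  "frobenius_norm A = L2_set (\<lambda>p. cmod (A $$ p)) ({..<dim_row A} \<times> {..<dim_col A})"
  by (simp add: frobenius_norm_def L2_set_def sum.cartesian_product')

interpretation frobenius: matrix_seminorm frobenius_norm N for N
proof
  fix A B :: "complex mat" and a :: complex
  assume A: "A \<in> carrier_mat N N"
  show "0 \<le> frobenius_norm A"
    by (simp add: frobenius_norm_L2_set)
  show "frobenius_norm (a \<cdot>\<^sub>m A) \<le> cmod a * frobenius_norm A"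
    using A by (auto simp: frobenius_norm_L2_set L2_set_right_distrib norm_mult intro!: L2_set_mono)
  assume B: "B \<in> carrier_mat N N"
  have "frobenius_norm (A + B)
      \<le> L2_set (\<lambda>p. cmod (A $$ p) + cmod (B $$ p)) ({..<N} \<times> {..<N})"
    using A B by (auto simp: frobenius_norm_L2_set intro!: L2_set_mono norm_triangle_ineq)
  also have "\<dots> \<le> frobenius_norm A + frobenius_norm B"
    using A B L2_set_triangle_ineq[of "\<lambda>p. cmod (A $$ p)" "\<lambda>p. cmod (B $$ p)" "{..<N} \<times> {..<N}"]
    by (simp add: frobenius_norm_L2_set)
  finally show "frobenius_norm (A + B) \<le> frobenius_norm A + frobenius_norm B" .
qed

section \<open>The spectral norm as an operator norm\<close>

lemma mult_mat_vec_index_sum: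
  "A \<in> carrier_mat M N \<Longrightarrow> w \<in> carrier_vec N \<Longrightarrow> i < M \<Longrightarrow>
    (A *\<^sub>v w) $ i = (\<Sum>j<N. A $$ (i, j) * w $ j)" for A :: "complex mat"
  by (simp add: scalar_prod_def lessThan_atLeast0)

text \<open>Cauchy-Schwarz in each row. It provides the upper bound that makes the supremum in
  \<open>spectral_norm\<close> meaningful.\<close>

lemma norm2_mult_mat_vec_le_frobenius:
  assumes A: "A \<in> carrier_mat N N" and w: "w \<in> carrier_vec N"
  shows "norm2 (A *\<^sub>v w) \<le> frobenius_norm A * norm2 w"
proof -
  have "norm2 (A *\<^sub>v w) \<le> L2_set (\<lambda>i. L2_set (\<lambda>j. cmod (A $$ (i, j))) {..<N} * norm2 w) {..<N}"
    unfolding norm2_L2_set[of "A *\<^sub>v w"]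
  proof (rule order_trans[OF _ L2_set_mono])
    show "L2_set (\<lambda>i. cmod ((A *\<^sub>v w) $ i)) {..<dim_vec (A *\<^sub>v w)}
        \<le> L2_set (\<lambda>i. cmod ((A *\<^sub>v w) $ i)) {..<N}"
      using A by simp
    fix i assume i: "i \<in> {..<N}"
    then have "cmod ((A *\<^sub>v w) $ i) \<le> (\<Sum>j<N. \<bar>cmod (A $$ (i, j))\<bar> * \<bar>cmod (w $ j)\<bar>)"
      using mult_mat_vec_index_sum[OF A w, of i]
      by (auto simp flip: norm_mult intro: norm_sum)
    also have "\<dots> \<le> L2_set (\<lambda>j. cmod (A $$ (i, j))) {..<N} * norm2 w"
      using w L2_set_mult_ineq[of "\<lambda>j. cmod (A $$ (i, j))" "\<lambda>j. cmod (w $ j)" "{..<N}"]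
      by (simp add: norm2_L2_set)
    finally show "cmod ((A *\<^sub>v w) $ i) \<le> L2_set (\<lambda>j. cmod (A $$ (i, j))) {..<N} * norm2 w" .
  qed simp
  also have "\<dots> = frobenius_norm A * norm2 w"
    using A by (simp add: norm2_nonneg frobenius_norm_def L2_set_def sum_nonneg power_mult_distrib
        real_sqrt_mult flip: sum_distrib_right)
  finally show ?thesis .
qed

lemma spectral_norm_bound:
  assumes A: "A \<in> carrier_mat N N" and w: "w \<in> carrier_vec N"
  shows "norm2 (A *\<^sub>v w) \<le> spectral_norm A * norm2 w"
proof (cases "norm2 w = 0")
  case True
  then have "A *\<^sub>v w = 0\<^sub>v N"
    using A w by (intro eq_vecI) (simp_all add: norm2_eq_0_iff[OF w])
  then show ?thesis
    using True norm2_eq_0_iff[of "A *\<^sub>v w" N] by simp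
next
  case False
  define c where "c = complex_of_real (inverse (norm2 w))"
  have c: "cmod c * norm2 w = 1"
    using False by (simp add: c_def norm2_nonneg norm_inverse)
  have bdd: "bdd_above {norm2 (A *\<^sub>v w) |w. w \<in> carrier_vec (dim_col A) \<and> norm2 w = 1}"
    using norm2_mult_mat_vec_le_frobenius[OF A] A by (intro bdd_aboveI[of _ "frobenius_norm A"]) force
  have "norm2 (A *\<^sub>v (c \<cdot>\<^sub>v w)) \<le> spectral_norm A"
    unfolding spectral_norm_def using A w c by (intro cSup_upper[OF _ bdd]) (auto simp: norm2_smult)
  moreover have "A *\<^sub>v (c \<cdot>\<^sub>v w) = c \<cdot>\<^sub>v (A *\<^sub>v w)"
    using A w by (simp add: mult_mat_vec)
  ultimately have "cmod c * norm2 (A *\<^sub>v w) \<le> spectral_norm A"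
    by (simp add: norm2_smult)
  then have "(cmod c * norm2 (A *\<^sub>v w)) * norm2 w \<le> spectral_norm A * norm2 w"
    by (rule mult_right_mono) (rule norm2_nonneg)
  moreover have "(cmod c * norm2 (A *\<^sub>v w)) * norm2 w = (cmod c * norm2 w) * norm2 (A *\<^sub>v w)"
    by simp
  ultimately show ?thesis
    using c by simp
qed

text \<open>A unit vector makes the set in the definition of \<open>spectral_norm\<close> nonempty;
  this is where \<open>0 < N\<close> enters.\<close>

lemma exists_norm2_one:
  assumes "0 < N"
  obtains w where "w \<in> carrier_vec N" "norm2 w = 1"
proof
  show "unit_vec N 0 \<in> carrier_vec N" by simp
  have "(\<Sum>i<N. (cmod (unit_vec N 0 $ i))\<^sup>2) = (\<Sum>i<N. if i = 0 then 1 else 0)"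
    by (rule sum.cong) auto
  then show "norm2 (unit_vec N 0) = 1"
    using assms by (simp add: norm2_def)
qed

lemma spectral_norm_le:
  assumes "A \<in> carrier_mat N N" "0 < N"
    and "\<And>w. w \<in> carrier_vec N \<Longrightarrow> norm2 w = 1 \<Longrightarrow> norm2 (A *\<^sub>v w) \<le> b"
  shows "spectral_norm A \<le> b"
  unfolding spectral_norm_def
proof (rule cSup_least)
  show "{norm2 (A *\<^sub>v w) |w. w \<in> carrier_vec (dim_col A) \<and> norm2 w = 1} \<noteq> {}"
    using exists_norm2_one[OF assms(2)] assms(1) by fastforce
qed (use assms in auto)

lemma matrix_seminorm_spectral:
  assumes N: "0 < N"
  shows "matrix_seminorm spectral_norm N"
proof
  fix A B :: "complex mat" and a :: complex
  assume A: "A \<in> carrier_mat N N"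
  obtain w where "w \<in> carrier_vec N" "norm2 w = 1"
    using exists_norm2_one[OF N] .
  then show "0 \<le> spectral_norm A"
    using spectral_norm_bound[OF A, of w] norm2_nonneg[of "A *\<^sub>v w"] by simp
  show "spectral_norm (a \<cdot>\<^sub>m A) \<le> cmod a * spectral_norm A"
  proof (rule spectral_norm_le[OF _ N])
    fix w assume w: "w \<in> carrier_vec N" "norm2 w = 1"
    have "(a \<cdot>\<^sub>m A) *\<^sub>v w = a \<cdot>\<^sub>v (A *\<^sub>v w)"
      using A w by (auto simp: vec_eq_iff)
    then show "norm2 ((a \<cdot>\<^sub>m A) *\<^sub>v w) \<le> cmod a * spectral_norm A"
      using spectral_norm_bound[OF A w(1)] w by (simp add: norm2_smult mult_left_mono)
  qed (use A in simp)
  assume B: "B \<in> carrier_mat N N"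
  show "spectral_norm (A + B) \<le> spectral_norm A + spectral_norm B"
  proof (rule spectral_norm_le[OF _ N])
    fix w assume w: "w \<in> carrier_vec N" "norm2 w = 1"
    have "norm2 ((A + B) *\<^sub>v w) \<le> norm2 (A *\<^sub>v w) + norm2 (B *\<^sub>v w)"
      using A B w by (simp add: add_mult_distrib_mat_vec[of _ N N] norm2_add[of _ N])
    then show "norm2 ((A + B) *\<^sub>v w) \<le> spectral_norm A + spectral_norm B"
      using spectral_norm_bound[OF A w(1)] spectral_norm_bound[OF B w(1)] w by simp
  qed (use A B in simp)
qed

section \<open>Backward errors on the imaginary axis\<close>

lemma mp_eval_carrier: "Q \<in> mat_polys k N \<Longrightarrow> mp_eval Q z \<in> carrier_mat N N"
  by (auto simp: mat_polys_def mp_eval_def)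

text \<open>The sum runs up to the grade \<open>k\<close>, not the degree of the entry; the
  additional coefficients vanish.\<close>

lemma mp_eval_index:
  assumes "Q \<in> mat_polys k N" "a < N" "b < N"
  shows "mp_eval Q z $$ (a, b) = (\<Sum>j\<le>k. z ^ j * mp_coeff Q j $$ (a, b))"
proof -
  let ?p = "Q $$ (a, b)"
  have "degree ?p \<le> k"
    using assms by (auto simp: mat_polys_def)
  then have "poly ?p z = (\<Sum>j\<le>k. coeff ?p j * z ^ j)"
    unfolding poly_altdef by (intro sum.mono_neutral_left) (auto simp: coeff_eq_0)
  then show ?thesis
    using assms by (auto simp: mat_polys_def mp_eval_def mp_coeff_def mult.commute)
qed

text \<open>Writing \<open>lam = \<i> * t\<close> with \<open>t\<close> real turns each term
  \<open>c * lam ^ j\<close> times the \<open>j\<close>-th coefficient into \<open>t ^ j\<close>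
  times a Hermitian matrix, and real combinations of Hermitian matrices are Hermitian.\<close>

lemma hermitian_phase_eval:
  assumes Q: "Q \<in> phase_class c k N" and lam: "Re lam = 0"
  shows "hermitian (c \<cdot>\<^sub>m mp_eval Q lam)"
proof -
  define t where "t = complex_of_real (Im lam)"
  have lam_eq: "lam = \<i> * t"
    using lam by (simp add: t_def complex_eq_iff)
  have Q': "Q \<in> mat_polys k N"
    using Q by (simp add: phase_class_def)
  let ?H = "\<lambda>j. (c * \<i> ^ j) \<cdot>\<^sub>m mp_coeff Q j"
  have H: "?H j \<in> carrier_mat N N" for j
    using mp_coeff_carrier[OF Q'] by simp
  have *: "(c \<cdot>\<^sub>m mp_eval Q lam) $$ (a, b) = (\<Sum>j\<le>k. t ^ j * ?H j $$ (a, b))"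
    if "a < N" "b < N" for a b
  proof -
    have "(c \<cdot>\<^sub>m mp_eval Q lam) $$ (a, b) = c * (\<Sum>j\<le>k. lam ^ j * mp_coeff Q j $$ (a, b))"
      using that mp_eval_carrier[OF Q', of lam] mp_eval_index[OF Q' that] by simp
    also have "\<dots> = (\<Sum>j\<le>k. t ^ j * ?H j $$ (a, b))"
      unfolding sum_distrib_left lam_eq power_mult_distrib
      using that carrier_matD[OF mp_coeff_carrier[OF Q']] by (intro sum.cong) (simp_all add: mult_ac)
    finally show ?thesis .
  qed
  have "cnj (?H j $$ (b, a)) = ?H j $$ (a, b)" if "a < N" "b < N" "j \<le> k" for a b j
    using Q that hermitian_iff[OF H[of j]] by (auto simp: phase_class_def)
  then have "cnj ((c \<cdot>\<^sub>m mp_eval Q lam) $$ (b, a)) = (c \<cdot>\<^sub>m mp_eval Q lam) $$ (a, b)"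
    if "a < N" "b < N" for a b
    unfolding *[OF that] *[OF that(2,1)] cnj_sum using that
    by (intro sum.cong) (simp_all only: complex_cnj_mult complex_cnj_power t_def complex_cnj_complex_of_real atMost_iff)
  then show ?thesis
    using mp_eval_carrier[OF Q', of lam] hermitian_iff[of "c \<cdot>\<^sub>m mp_eval Q lam" N] smult_carrier_mat
    by blast
qed

text \<open>
  On the imaginary axis \<open>c Q(lam)\<close> ranges over Hermitian matrices \<open>E\<close>; the cheapest perturbation
  with prescribed value \<open>E\<close> distributes it over the coefficients proportionally to \<open>cnj (lam\<^sup>j)\<close>.
\<close>

lemma (in matrix_seminorm) backward_error_phase_class:
  assumes c: "cmod c = 1" and lam: "Re lam = 0" and Q: "Q \<in> mat_polys k N"
    and u: "u \<in> carrier_vec N"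
    and E0: "E0 \<in> carrier_mat N N" "hermitian E0" "E0 *\<^sub>v u = c \<cdot>\<^sub>v (mp_eval Q lam *\<^sub>v u)"
    and min: "\<And>E. E \<in> carrier_mat N N \<Longrightarrow> hermitian E \<Longrightarrow>
      E *\<^sub>v u = c \<cdot>\<^sub>v (mp_eval Q lam *\<^sub>v u) \<Longrightarrow> \<mu> E0 \<le> \<mu> E"
  shows "backward_error \<mu> k (phase_class c k N) lam u Q = \<mu> E0 / L2_set (\<lambda>j. cmod lam ^ j) {..k}"
proof -
  define l where "l = L2_set (\<lambda>j. cmod lam ^ j) {..k}"
  have l2: "l\<^sup>2 = (\<Sum>j\<le>k. (cmod lam ^ j)\<^sup>2)"
    by (simp add: l_def L2_set_def sum_nonneg)
  \<comment> \<open>The index 0 contributes 1, so \<open>l\<close> is positive also for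
    \<open>lam = 0\<close>.\<close>
  have "1 \<le> l"
    using member_le_L2_set[of "{..k}" 0 "\<lambda>j. cmod lam ^ j"] by (simp add: l_def)
  then have l: "0 < l" by simp
  have mp_norm: "mp_norm \<mu> k D = L2_set (\<lambda>j. \<mu> (mp_coeff D j)) {..k}" for D
    by (simp add: mp_norm_def L2_set_def)
  let ?b = "mp_eval Q lam *\<^sub>v u"
  let ?A = "{D \<in> phase_class c k N. ?b + mp_eval D lam *\<^sub>v u = 0\<^sub>v N}"
  have b: "?b \<in> carrier_vec N"
    using mp_eval_carrier[OF Q] u by (rule mult_mat_vec_carrier)
  have cc: "cnj c * c = 1" "c * cnj c = 1"
    using c complex_norm_square[of c] by (simp_all add: mult.commute[of "cnj c"])

  \<comment> \<open>Up to the factor \<open>- c\<close>, the value of an admissible \<open>D\<close>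
    at \<open>lam\<close> competes with \<open>E0\<close> in \<open>min\<close>. The triangle
    inequality over the coefficients and Cauchy-Schwarz then produce the factor
    \<open>l\<close>.\<close>
  have lower: "\<mu> E0 / l \<le> mp_norm \<mu> k D" if D: "D \<in> ?A" for D
  proof -
    let ?C = "mp_coeff D"
    have D': "D \<in> mat_polys k N"
      using D by (simp add: phase_class_def)
    define E where "E = (- c) \<cdot>\<^sub>m mp_eval D lam"
    have E: "E \<in> carrier_mat N N"
      using mp_eval_carrier[OF D'] by (simp add: E_def)
    have "E = (- 1) \<cdot>\<^sub>m (c \<cdot>\<^sub>m mp_eval D lam)"
      by (auto simp: E_def mat_eq_iff)
    then have "hermitian E"
      using D lam mp_eval_carrier[OF D', of lam]
      by (simp only:) (rule hermitian_smult_real[of _ N], auto intro: hermitian_phase_eval)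
    moreover have "E *\<^sub>v u = c \<cdot>\<^sub>v ?b"
    proof (rule eq_vecI)
      fix i assume i: "i < dim_vec (c \<cdot>\<^sub>v ?b)"
      then have i: "i < N"
        using mp_eval_carrier[OF Q, of lam] by simp
      have "(?b + mp_eval D lam *\<^sub>v u) $ i = 0"
        using D i by simp
      then have "?b $ i = - (mp_eval D lam *\<^sub>v u) $ i"
        using b i mp_eval_carrier[OF D', of lam] mp_eval_carrier[OF Q, of lam] u by (simp add: add_eq_0_iff2)
      moreover have "(E *\<^sub>v u) $ i = - c * (mp_eval D lam *\<^sub>v u) $ i"
        using i u mp_eval_carrier[OF D', of lam] by (simp add: E_def)
      moreover have "(c \<cdot>\<^sub>v ?b) $ i = c * ?b $ i"
        using i mp_eval_carrier[OF Q, of lam] by simp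
      ultimately show "(E *\<^sub>v u) $ i = (c \<cdot>\<^sub>v ?b) $ i"
        by simp
    qed (use E mp_eval_carrier[OF Q, of lam] in simp)
    ultimately have "\<mu> E0 \<le> \<mu> E"
      by (intro min E)
    also have "E = mat N N (\<lambda>p. \<Sum>j\<le>k. (- (c * lam ^ j)) * ?C j $$ p)"
      using mp_eval_carrier[OF D', of lam]
      by (intro eq_matI) (simp_all add: E_def mp_eval_index[OF D'] sum_distrib_left sum_negf mult.assoc)
    also have "\<mu> \<dots> \<le> (\<Sum>j\<le>k. cmod (- (c * lam ^ j)) * \<mu> (?C j))"
      by (rule lincomb_le) (rule mp_coeff_carrier[OF D'])
    also have "\<dots> = (\<Sum>j\<le>k. \<bar>cmod lam ^ j\<bar> * \<bar>\<mu> (?C j)\<bar>)"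
      using nonneg[OF mp_coeff_carrier[OF D']] c by (simp add: norm_mult norm_power)
    also have "\<dots> \<le> l * mp_norm \<mu> k D"
      unfolding l_def mp_norm by (rule L2_set_mult_ineq)
    finally show ?thesis
      using l by (simp add: field_simps)
  qed

  \<comment> \<open>The coefficients \<open>g j\<close> times \<open>E0\<close> have norms
    proportional to \<open>cmod lam ^ j\<close>, the equality case of the Cauchy-Schwarz step above.
    The scaling gives \<open>D\<close> the value \<open>- cnj c\<close> times \<open>E0\<close> at
    \<open>lam\<close>, which cancels the residual because \<open>cnj c * c = 1\<close>.\<close>
  define g where "g j = - cnj (c * lam ^ j) / complex_of_real (l\<^sup>2)" for j
  define D where "D = mat N N (\<lambda>(a, b). \<Sum>j\<le>k. monom (g j * E0 $$ (a, b)) j)"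
  have deg: "degree (\<Sum>j\<le>k. monom (g j * E0 $$ (a, b)) j) \<le> k" for a b
    by (intro degree_sum_le) (auto intro: order_trans[OF degree_monom_le])
  then have D: "D \<in> mat_polys k N"
    by (simp add: D_def mat_polys_def)
  have coeff: "mp_coeff D j = g j \<cdot>\<^sub>m E0" if "j \<le> k" for j
    using E0 that by (intro eq_matI) (simp_all add: mp_coeff_def D_def coeff_sum)
  have lam_cnj: "lam ^ j * cnj (lam ^ j) = complex_of_real ((cmod lam ^ j)\<^sup>2)" for j
    using complex_norm_square[of "lam ^ j"] by (simp add: norm_power)
  have "(\<Sum>j\<le>k. lam ^ j * g j) = - cnj c * (\<Sum>j\<le>k. lam ^ j * cnj (lam ^ j)) / complex_of_real (l\<^sup>2)"
    by (simp add: g_def sum_distrib_left sum_divide_distrib sum_negf mult_ac)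
  also have "(\<Sum>j\<le>k. lam ^ j * cnj (lam ^ j)) = complex_of_real (l\<^sup>2)"
    unfolding lam_cnj l2 by simp
  finally have sum_g: "(\<Sum>j\<le>k. lam ^ j * g j) = - cnj c"
    using l by simp
  have "mp_eval D lam = (- cnj c) \<cdot>\<^sub>m E0"
    using E0 mp_eval_carrier[OF D, of lam]
    by (intro eq_matI) (simp_all add: mp_eval_index[OF D] coeff sum_g[symmetric] sum_distrib_right mult.assoc)
  moreover have "((- cnj c) \<cdot>\<^sub>m E0) *\<^sub>v u = (- cnj c) \<cdot>\<^sub>v (E0 *\<^sub>v u)"
    using E0(1) u by (intro eq_vecI) simp_all
  ultimately have "mp_eval D lam *\<^sub>v u = (- cnj c * c) \<cdot>\<^sub>v ?b"
    unfolding E0 by (simp add: smult_smult_assoc)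
  then have "?b + mp_eval D lam *\<^sub>v u = 0\<^sub>v N"
    using mp_eval_carrier[OF Q, of lam] by (intro eq_vecI) (simp_all add: cc)
  moreover have "D \<in> phase_class c k N"
    unfolding phase_class_def
  proof (intro CollectI conjI D allI impI)
    fix j assume j: "j \<le> k"
    \<comment> \<open>For imaginary \<open>lam\<close> the phases in
      \<open>c * \<i> ^ j * g j\<close> cancel in conjugate pairs. The product is real, so
      \<open>D\<close> keeps the structure.\<close>
    define t where "t = complex_of_real (Im lam)"
    have "cnj lam = cnj \<i> * t"
      using lam by (simp add: t_def complex_eq_iff)
    then have "cnj lam ^ j = cnj \<i> ^ j * t ^ j"
      by (simp only: power_mult_distrib)
    then have "c * \<i> ^ j * g j = - ((c * cnj c) * (\<i> ^ j * cnj (\<i> ^ j)) * t ^ j / complex_of_real (l\<^sup>2))"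
      by (simp add: g_def)
    also have "\<i> ^ j * cnj (\<i> ^ j) = 1"
      using complex_norm_square[of "\<i> ^ j"] by (simp add: norm_power)
    also have "- ((c * cnj c) * 1 * t ^ j / complex_of_real (l\<^sup>2)) = complex_of_real (- (Im lam ^ j) / l\<^sup>2)"
      unfolding cc by (simp add: t_def)
    finally have "(c * \<i> ^ j) \<cdot>\<^sub>m mp_coeff D j = complex_of_real (- (Im lam ^ j) / l\<^sup>2) \<cdot>\<^sub>m E0"
      using E0 by (intro eq_matI) (simp_all add: coeff[OF j] mult.assoc[symmetric])
    then show "hermitian ((c * \<i> ^ j) \<cdot>\<^sub>m mp_coeff D j)"
      using E0 by (simp only:) (rule hermitian_smult_real[of _ N], simp_all)
  qed
  ultimately have DA: "D \<in> ?A"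
    by simp
  have "mp_norm \<mu> k D \<le> L2_set (\<lambda>j. cmod lam ^ j * (\<mu> E0 / l\<^sup>2)) {..k}"
    unfolding mp_norm
  proof (rule L2_set_mono)
    fix j assume "j \<in> {..k}"
    then have "\<mu> (mp_coeff D j) \<le> cmod (g j) * \<mu> E0"
      using smult_le[OF E0(1)] by (simp add: coeff)
    also have "cmod (g j) = cmod lam ^ j / l\<^sup>2"
      using c by (simp add: g_def norm_divide norm_mult norm_power)
    finally show "\<mu> (mp_coeff D j) \<le> cmod lam ^ j * (\<mu> E0 / l\<^sup>2)"
      by simp
  qed (rule nonneg[OF mp_coeff_carrier[OF D]])
  also have "\<dots> = l * (\<mu> E0 / l\<^sup>2)"
    unfolding l_def[symmetric] by (simp only: L2_set_left_distrib[symmetric] l_def nonneg[OF E0(1)] zero_le_divide_iff zero_le_power2 simp_thms)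
  also have "\<dots> = \<mu> E0 / l"
    by (simp add: power2_eq_square)
  finally have "\<mu> E0 / l = mp_norm \<mu> k D"
    using lower[OF DA] by simp
  then have "\<mu> E0 / l \<in> mp_norm \<mu> k ` ?A"
    using DA by (rule image_eqI)
  \<comment> \<open>The lower bound is attained at \<open>D\<close>, so the infimum is a
    minimum.\<close>
  then have "Inf (mp_norm \<mu> k ` ?A) = \<mu> E0 / l"
    using lower by (intro cInf_eq_minimum) auto
  moreover have "backward_error \<mu> k (phase_class c k N) lam u Q = Inf (mp_norm \<mu> k ` ?A)"
    using Q unfolding backward_error_def by (intro arg_cong[of _ _ Inf]) (auto simp: mat_polys_def)
  ultimately show ?thesis
    by (simp add: l_def)
qed

section \<open>Hermitian matrices of least norm with a prescribed image of \<open>u\<close>\<close>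

lemma cnj_cscalar_prod_hermitian:
  assumes E: "E \<in> carrier_mat N N" "hermitian E" and u: "u \<in> carrier_vec N" and w: "w \<in> carrier_vec N"
  shows "cnj ((E *\<^sub>v u) \<bullet>c w) = (E *\<^sub>v w) \<bullet>c u"
proof -
  have her: "cnj (E $$ (i, j)) = E $$ (j, i)" if "i < N" "j < N" for i j
    using E that by (simp add: hermitian_iff[of _ N])
  have dims: "dim_vec u = N" "dim_vec w = N" "dim_row E = N"
    using E u w by simp_all
  have "cnj ((E *\<^sub>v u) \<bullet>c w) = (\<Sum>i<N. \<Sum>j<N. E $$ (j, i) * w $ i * cnj (u $ j))"
    unfolding cscalar_prod_sum dims cnj_sum
    by (intro sum.cong)
      (simp_all add: mult_mat_vec_index_sum[OF E(1) u] her sum_distrib_right sum_distrib_left mult_ac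
        del: index_mult_mat_vec)
  also have "\<dots> = (\<Sum>j<N. \<Sum>i<N. E $$ (j, i) * w $ i * cnj (u $ j))"
    by (rule sum.swap)
  also have "\<dots> = (E *\<^sub>v w) \<bullet>c u"
    unfolding cscalar_prod_sum dims
    by (intro sum.cong)
      (simp_all add: mult_mat_vec_index_sum[OF E(1) w] sum_distrib_right del: index_mult_mat_vec)
  finally show ?thesis .
qed

text \<open>A Hermitian \<open>E\<close> with \<open>E *\<^sub>v u = r\<close> can exist only if
  \<open>r \<bullet>c u\<close> is real. The two minimizer constructions take this condition as a
  hypothesis.\<close>

lemma Im_cscalar_prod_hermitian:
  assumes "E \<in> carrier_mat N N" "hermitian E" "u \<in> carrier_vec N"
  shows "Im ((E *\<^sub>v u) \<bullet>c u) = 0"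
  using cnj_cscalar_prod_hermitian[OF assms assms(3)] by (simp add: complex_eq_iff)

text \<open>A multiple of the Householder reflection that exchanges \<open>u\<close> and \<open>r\<close> up to scaling.\<close>

lemma spectral_minimizer:
  assumes u: "u \<in> carrier_vec N" "norm2 u \<noteq> 0" and r: "r \<in> carrier_vec N" and N: "0 < N"
    and real: "Im (r \<bullet>c u) = 0"
  obtains E where "E \<in> carrier_mat N N" "hermitian E" "E *\<^sub>v u = r" "spectral_norm E \<le> norm2 r / norm2 u"
proof -
  \<comment> \<open>The scaling gives \<open>\<rho>c \<cdot>\<^sub>v u\<close> and \<open>r\<close>
    equal norms. Since their inner product is real, the reflection along their difference
    \<open>w\<close> exchanges them, and \<open>\<rho>\<close> times this reflection maps
    \<open>u\<close> to \<open>r\<close>.\<close>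
  define \<rho> where "\<rho> = norm2 r / norm2 u"
  define \<rho>c where "\<rho>c = complex_of_real \<rho>"
  define w where "w = \<rho>c \<cdot>\<^sub>v u - r"
  have w: "w \<in> carrier_vec N"
    using u r by (simp add: w_def)
  define q where "q = w \<bullet>c w"
  have q_real: "cnj q = q"
    using w by (simp add: q_def cscalar_prod_self)
  define E where "E = mat N N (\<lambda>(a, b). (if a = b then \<rho>c else 0) - 2 * \<rho>c / q * w $ a * cnj (w $ b))"
  have E: "E \<in> carrier_mat N N"
    by (simp add: E_def)
  have "hermitian E"
    unfolding hermitian_iff[OF E] by (auto simp: E_def \<rho>c_def q_real mult_ac)
  have Ez: "E *\<^sub>v z = \<rho>c \<cdot>\<^sub>v (z - (2 * (z \<bullet>c w) / (w \<bullet>c w)) \<cdot>\<^sub>v w)" if z: "z \<in> carrier_vec N" for z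
  proof (rule eq_vecI)
    fix a assume "a < dim_vec (\<rho>c \<cdot>\<^sub>v (z - (2 * (z \<bullet>c w) / (w \<bullet>c w)) \<cdot>\<^sub>v w))"
    then have a: "a < N"
      using w by simp
    have "(E *\<^sub>v z) $ a = (\<Sum>b<N. (if a = b then \<rho>c else 0) * z $ b - 2 * \<rho>c / q * w $ a * (z $ b * cnj (w $ b)))"
      unfolding mult_mat_vec_index_sum[OF E z a] using a
      by (intro sum.cong) (simp_all add: E_def algebra_simps)
    also have "\<dots> = \<rho>c * z $ a - 2 * \<rho>c / q * w $ a * (z \<bullet>c w)"
      using a w by (simp add: sum_subtractf sum_distrib_left cscalar_prod_sum if_distrib[of "\<lambda>x. x * _"] cong: if_cong)
    also have "\<dots> = (\<rho>c \<cdot>\<^sub>v (z - (2 * (z \<bullet>c w) / (w \<bullet>c w)) \<cdot>\<^sub>v w)) $ a"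
      using a w z by (simp add: q_def right_diff_distrib)
    finally show "(E *\<^sub>v z) $ a = (\<rho>c \<cdot>\<^sub>v (z - (2 * (z \<bullet>c w) / (w \<bullet>c w)) \<cdot>\<^sub>v w)) $ a" .
  qed (use E w in simp)
  have \<rho>: "0 \<le> \<rho>"
    by (simp add: \<rho>_def norm2_nonneg)
  have norm_E: "norm2 (E *\<^sub>v z) = \<rho> * norm2 z" if "z \<in> carrier_vec N" for z
    using norm2_reflection[OF that w] \<rho> by (simp add: Ez[OF that] norm2_smult \<rho>c_def)
  have ru: "u \<bullet>c r = r \<bullet>c u"
    using u r cscalar_prod_swap[of r u] real by (auto simp: complex_eq_iff)
  have uu: "\<rho>c * \<rho>c * (u \<bullet>c u) = r \<bullet>c r"
    using u by (simp add: cscalar_prod_self \<rho>c_def \<rho>_def power2_eq_square)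
  have uw: "u \<bullet>c w = \<rho>c * (u \<bullet>c u) - u \<bullet>c r"
    using u r by (simp add: w_def cscalar_prod_sum \<rho>c_def algebra_simps sum_subtractf sum_distrib_left)
  have "q = \<rho>c * \<rho>c * (u \<bullet>c u) - \<rho>c * (u \<bullet>c r) - \<rho>c * (r \<bullet>c u) + r \<bullet>c r"
    using u r by (simp add: q_def w_def cscalar_prod_sum \<rho>c_def algebra_simps sum_subtractf sum.distrib sum_distrib_left)
  \<comment> \<open>Hence the reflection subtracts exactly \<open>w\<close> from
    \<open>\<rho>c \<cdot>\<^sub>v u\<close>, leaving \<open>r\<close>.\<close>
  then have key: "2 * \<rho>c * (u \<bullet>c w) = q"
    using uu by (simp add: uw ru algebra_simps)
  have "E *\<^sub>v u = r"
  proof (cases "q = 0")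
    \<comment> \<open>Here \<open>r\<close> is already a multiple of \<open>u\<close>, and division
      by \<open>q = 0\<close> reduces \<open>E\<close> to \<open>\<rho>\<close> times the
      identity.\<close>
    case True
    then have "w = 0\<^sub>v N"
      using norm2_eq_0_iff[OF w] by (simp add: q_def cscalar_prod_self)
    then have "w $ i = 0" if "i < N" for i
      using that by simp
    then have "r = \<rho>c \<cdot>\<^sub>v u"
      using u r by (intro eq_vecI) (auto simp: w_def)
    moreover have "E *\<^sub>v u = \<rho>c \<cdot>\<^sub>v u"
      using True u w by (intro eq_vecI) (auto simp: Ez q_def)
    ultimately show ?thesis by simp
  next
    case False
    then have "\<rho>c * (2 * (u \<bullet>c w) / (w \<bullet>c w)) = 1"
      using key by (simp add: q_def mult_ac)
    then show ?thesis
      using u r w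
      by (intro eq_vecI) (simp_all add: Ez right_diff_distrib mult.assoc[symmetric], simp add: w_def)
  qed
  moreover have "spectral_norm E \<le> \<rho>"
    by (rule spectral_norm_le[OF E N]) (simp add: norm_E)
  ultimately show ?thesis
    using that E \<open>hermitian E\<close> by (simp add: \<rho>_def)
qed

lemma frobenius_norm_squared:
  "A \<in> carrier_mat N N \<Longrightarrow> (frobenius_norm A)\<^sup>2 = (\<Sum>a<N. \<Sum>b<N. (cmod (A $$ (a, b)))\<^sup>2)"
  by (simp add: frobenius_norm_def sum_nonneg)

text \<open>
  The minimizer lies in the span of \<open>r u\<^sup>*\<close>, \<open>u r\<^sup>*\<close> and \<open>u u\<^sup>*\<close>, so its Frobenius inner product
  with a Hermitian \<open>E\<close> depends on \<open>E u\<close> only.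
\<close>

lemma frobenius_minimizer:
  assumes u: "u \<in> carrier_vec N" "norm2 u \<noteq> 0" and r: "r \<in> carrier_vec N"
    and real: "Im (r \<bullet>c u) = 0"
  obtains E0 where "E0 \<in> carrier_mat N N" "hermitian E0" "E0 *\<^sub>v u = r"
    "frobenius_norm E0 = sqrt (2 * (norm2 r / norm2 u)\<^sup>2 - (cmod (r \<bullet>c u) / (norm2 u)\<^sup>2)\<^sup>2)"
    "\<And>E. E \<in> carrier_mat N N \<Longrightarrow> hermitian E \<Longrightarrow> E *\<^sub>v u = r \<Longrightarrow> frobenius_norm E0 \<le> frobenius_norm E"
proof -
  define s where "s = (norm2 u)\<^sup>2"
  define sc where "sc = complex_of_real s"
  define \<alpha> where "\<alpha> = r \<bullet>c u"
  have s: "s \<noteq> 0" "sc \<noteq> 0" and uu: "u \<bullet>c u = sc"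
    using u by (simp_all add: s_def sc_def cscalar_prod_self)
  have \<alpha>: "cnj \<alpha> = \<alpha>" "u \<bullet>c r = \<alpha>"
    using u r real cscalar_prod_swap[of r u] by (auto simp: complex_eq_iff \<alpha>_def)
  \<comment> \<open>The first two terms form a Hermitian matrix that maps \<open>u\<close> to
    \<open>r\<close> plus the multiple \<open>\<alpha> / sc\<close> of \<open>u\<close>; the last
    term removes this excess.\<close>
  define E0 where
    "E0 = mat N N (\<lambda>(a, b). (r $ a * cnj (u $ b) + u $ a * cnj (r $ b)) / sc - \<alpha> / sc\<^sup>2 * u $ a * cnj (u $ b))"
  define g where "g = 2 * (norm2 r)\<^sup>2 / s - (cmod \<alpha>)\<^sup>2 / s\<^sup>2"
  have E0: "E0 \<in> carrier_mat N N"
    by (simp add: E0_def)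
  have herm0: "hermitian E0"
    unfolding hermitian_iff[OF E0] by (auto simp: E0_def sc_def \<alpha> mult_ac add_ac)
  have E0u: "E0 *\<^sub>v u = r"
  proof (rule eq_vecI)
    fix a assume "a < dim_vec r"
    then have a: "a < N"
      using r by simp
    have "(E0 *\<^sub>v u) $ a = (\<Sum>b<N. r $ a / sc * (u $ b * cnj (u $ b)) + u $ a / sc * (u $ b * cnj (r $ b))
        - \<alpha> / sc\<^sup>2 * u $ a * (u $ b * cnj (u $ b)))"
      unfolding mult_mat_vec_index_sum[OF E0 u(1) a] using a s
      by (intro sum.cong) (simp_all add: E0_def field_simps)
    also have "\<dots> = r $ a / sc * (u \<bullet>c u) + u $ a / sc * (u \<bullet>c r) - \<alpha> / sc\<^sup>2 * u $ a * (u \<bullet>c u)"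
      using u r by (simp add: cscalar_prod_sum sum.distrib sum_subtractf sum_distrib_left)
    also have "\<dots> = r $ a"
      unfolding uu \<alpha> using s by (simp add: field_simps power2_eq_square)
    finally show "(E0 *\<^sub>v u) $ a = r $ a" .
  qed (use r E0 in simp)
  have inner: "(\<Sum>a<N. \<Sum>b<N. E $$ (a, b) * cnj (E0 $$ (a, b))) = complex_of_real g"
    if E: "E \<in> carrier_mat N N" "hermitian E" "E *\<^sub>v u = r" for E
  proof -
    have prod: "(\<Sum>a<N. \<Sum>b<N. E $$ (a, b) * (cnj (y $ a) * z $ b)) = (E *\<^sub>v z) \<bullet>c y"
      if y: "y \<in> carrier_vec N" and z: "z \<in> carrier_vec N" for y z
    proof -
      have "dim_vec y = N" using y by simp
      then show ?thesis
        unfolding cscalar_prod_sum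
        by (intro sum.cong) (simp_all add: mult_mat_vec_index_sum[OF E(1) z] sum_distrib_right
            sum_distrib_left mult_ac del: index_mult_mat_vec)
    qed
    \<comment> \<open>Being Hermitian lets \<open>E\<close> be moved to \<open>u\<close>, whose
      image is known. No unknown entry of \<open>E\<close> remains in the inner product with
      \<open>E0\<close>.\<close>
    have "(E *\<^sub>v r) \<bullet>c u = r \<bullet>c r"
      using cnj_cscalar_prod_hermitian[OF E(1,2) u(1) r] by (simp add: E(3) cscalar_prod_self)
    note vals = this E(3)
    have "(\<Sum>a<N. \<Sum>b<N. E $$ (a, b) * cnj (E0 $$ (a, b)))
        = (\<Sum>a<N. \<Sum>b<N. (E $$ (a, b) * (cnj (r $ a) * u $ b)) / sc
            + (E $$ (a, b) * (cnj (u $ a) * r $ b)) / sc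
            - \<alpha> / sc\<^sup>2 * (E $$ (a, b) * (cnj (u $ a) * u $ b)))"
      using s by (intro sum.cong) (simp_all add: E0_def \<alpha> sc_def field_simps)
    also have "\<dots> = ((E *\<^sub>v u) \<bullet>c r) / sc + ((E *\<^sub>v r) \<bullet>c u) / sc - \<alpha> / sc\<^sup>2 * ((E *\<^sub>v u) \<bullet>c u)"
      unfolding prod[OF r u(1), symmetric] prod[OF u(1) r, symmetric] prod[OF u(1) u(1), symmetric]
      by (simp only: sum.distrib sum_subtractf sum_distrib_left sum_divide_distrib)
    also have "\<dots> = 2 * (r \<bullet>c r) / sc - \<alpha> * \<alpha> / sc\<^sup>2"
      unfolding vals by (simp add: \<alpha>_def)
    also have "\<alpha> * \<alpha> = complex_of_real ((cmod \<alpha>)\<^sup>2)"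
      by (simp only: complex_norm_square \<alpha>)
    finally show ?thesis
      by (simp add: g_def cscalar_prod_self sc_def)
  qed
  have "complex_of_real ((frobenius_norm E0)\<^sup>2) = (\<Sum>a<N. \<Sum>b<N. E0 $$ (a, b) * cnj (E0 $$ (a, b)))"
    unfolding frobenius_norm_squared[OF E0] of_real_sum complex_norm_square ..
  \<comment> \<open>\<open>E0\<close> is itself one of the matrices covered by \<open>inner\<close>,
    so \<open>g\<close> is its squared norm.\<close>
  then have g: "(frobenius_norm E0)\<^sup>2 = g"
    unfolding inner[OF E0 herm0 E0u] of_real_eq_iff .
  have min: "frobenius_norm E0 \<le> frobenius_norm E"
    if E: "E \<in> carrier_mat N N" "hermitian E" "E *\<^sub>v u = r" for E
  proof -
    \<comment> \<open>Every competitor has the same inner product with \<open>E0\<close> as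
      \<open>E0\<close> itself, that is, \<open>E - E0\<close> is orthogonal to \<open>E0\<close>.
      Cauchy-Schwarz then gives minimality.\<close>
    have "(frobenius_norm E0)\<^sup>2 = cmod (\<Sum>p\<in>{..<N} \<times> {..<N}. E $$ p * cnj (E0 $$ p))"
      using inner[OF E] g zero_le_power2[of "frobenius_norm E0"] by (simp add: sum.cartesian_product')
    also have "\<dots> \<le> (\<Sum>p\<in>{..<N} \<times> {..<N}. \<bar>cmod (E $$ p)\<bar> * \<bar>cmod (E0 $$ p)\<bar>)"
      by (rule order_trans[OF norm_sum]) (simp add: norm_mult)
    also have "\<dots> \<le> frobenius_norm E * frobenius_norm E0"
      using E E0 L2_set_mult_ineq[of "\<lambda>p. cmod (E $$ p)" "\<lambda>p. cmod (E0 $$ p)" "{..<N} \<times> {..<N}"]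
      by (simp add: frobenius_norm_L2_set)
    finally have "frobenius_norm E0 * frobenius_norm E0 \<le> frobenius_norm E * frobenius_norm E0"
      by (simp add: power2_eq_square)
    moreover have "0 \<le> frobenius_norm E0" "0 \<le> frobenius_norm E"
      using E E0 by (simp_all add: frobenius.nonneg)
    ultimately show ?thesis
      by (cases "frobenius_norm E0 = 0") (simp_all add: mult_le_cancel_right)
  qed
  have "frobenius_norm E0 = sqrt g"
    unfolding g[symmetric] using frobenius.nonneg[OF E0] by simp
  also have "g = 2 * (norm2 r / norm2 u)\<^sup>2 - (cmod (r \<bullet>c u) / (norm2 u)\<^sup>2)\<^sup>2"
    by (simp add: g_def s_def \<alpha>_def power_divide)
  finally show ?thesis
    by (rule that[OF E0 herm0 E0u _ min])
qed

text \<open>The unimodular factor \<open>c\<close> is moved into \<open>r\<close>, where it changes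
  neither the norm nor the modulus of the inner product with \<open>u\<close>. The formulas are
  therefore the same for both structures.\<close>

lemma backward_error_formulas:
  assumes c: "cmod c = 1" and lam: "Re lam = 0" and Q: "Q \<in> phase_class c k N"
    and u: "u \<in> carrier_vec N" "norm2 u \<noteq> 0" and N: "0 < N"
  defines "b \<equiv> mp_eval Q lam *\<^sub>v u" and "l \<equiv> L2_set (\<lambda>j. cmod lam ^ j) {..k}"
  shows "backward_error spectral_norm k (phase_class c k N) lam u Q = norm2 b / norm2 u / l"
    and "backward_error frobenius_norm k (phase_class c k N) lam u Q
      = sqrt (2 * (norm2 b / norm2 u)\<^sup>2 - (cmod (b \<bullet>c u) / (norm2 u)\<^sup>2)\<^sup>2) / l"
proof -
  have Q': "Q \<in> mat_polys k N"
    using Q by (simp add: phase_class_def)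
  define r where "r = c \<cdot>\<^sub>v b"
  have b: "b \<in> carrier_vec N"
    unfolding b_def using mp_eval_carrier[OF Q'] u(1) by (rule mult_mat_vec_carrier)
  then have r: "r \<in> carrier_vec N"
    by (simp add: r_def)
  have "r = (c \<cdot>\<^sub>m mp_eval Q lam) *\<^sub>v u"
    using mp_eval_carrier[OF Q', of lam] u by (intro eq_vecI) (simp_all add: r_def b_def)
  then have real: "Im (r \<bullet>c u) = 0"
    using Im_cscalar_prod_hermitian[OF _ hermitian_phase_eval[OF Q lam] u(1)]
      mp_eval_carrier[OF Q', of lam] by simp
  have norm_r: "norm2 r = norm2 b" "cmod (r \<bullet>c u) = cmod (b \<bullet>c u)"
    using b u c by (simp_all add: r_def norm2_smult norm_mult)
  interpret spectral: matrix_seminorm spectral_norm N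
    using N by (rule matrix_seminorm_spectral)
  obtain E where E: "E \<in> carrier_mat N N" "hermitian E" "E *\<^sub>v u = r" "spectral_norm E \<le> norm2 r / norm2 u"
    by (rule spectral_minimizer[OF u r N real])
  \<comment> \<open>An operator norm is at least the stretching of the single vector
    \<open>u\<close>, which the scaled reflection attains.\<close>
  have low: "norm2 r / norm2 u \<le> spectral_norm F" if "F \<in> carrier_mat N N" "F *\<^sub>v u = r" for F
    using spectral_norm_bound[OF that(1) u(1)] that(2) u(2) norm2_nonneg[of u]
    by (simp add: divide_le_eq)
  have "spectral_norm E = norm2 b / norm2 u"
    using low[OF E(1,3)] E(4) by (simp add: norm_r)
  moreover have "backward_error spectral_norm k (phase_class c k N) lam u Q = spectral_norm E / l"
    unfolding l_def
  proof (rule spectral.backward_error_phase_class[OF c lam Q' u(1) E(1,2)])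
    show "E *\<^sub>v u = c \<cdot>\<^sub>v (mp_eval Q lam *\<^sub>v u)"
      using E(3) by (simp add: r_def b_def)
    show "spectral_norm E \<le> spectral_norm F"
      if "F \<in> carrier_mat N N" "F *\<^sub>v u = c \<cdot>\<^sub>v (mp_eval Q lam *\<^sub>v u)" for F
      using low[OF that(1)] E(4) that(2) by (simp add: r_def b_def)
  qed
  ultimately show "backward_error spectral_norm k (phase_class c k N) lam u Q = norm2 b / norm2 u / l"
    by simp
  obtain F where F: "F \<in> carrier_mat N N" "hermitian F" "F *\<^sub>v u = r"
    "frobenius_norm F = sqrt (2 * (norm2 r / norm2 u)\<^sup>2 - (cmod (r \<bullet>c u) / (norm2 u)\<^sup>2)\<^sup>2)"
    "\<And>E. E \<in> carrier_mat N N \<Longrightarrow> hermitian E \<Longrightarrow> E *\<^sub>v u = r \<Longrightarrow> frobenius_norm F \<le> frobenius_norm E"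
    using frobenius_minimizer[OF u r real] by blast
  have "backward_error frobenius_norm k (phase_class c k N) lam u Q = frobenius_norm F / l"
    unfolding l_def
    by (rule frobenius.backward_error_phase_class[OF c lam Q' u(1) F(1,2)])
      (use F(3,5) in \<open>simp_all add: r_def b_def\<close>)
  then show "backward_error frobenius_norm k (phase_class c k N) lam u Q
      = sqrt (2 * (norm2 b / norm2 u)\<^sup>2 - (cmod (b \<bullet>c u) / (norm2 u)\<^sup>2)\<^sup>2) / l"
    by (simp add: F(4) norm_r)
qed

section \<open>Kronecker products and the comparison\<close>

lemma kron_vec_index:
  assumes "i < dim_vec a * dim_vec y"
  shows "kron_vec a y $ i = a $ (i div dim_vec y) * y $ (i mod dim_vec y)"
proof -
  have "0 < dim_vec y"
    using assms by (cases "dim_vec y") auto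
  then show ?thesis
    using assms by (simp add: kron_vec_def kron_def col_mat_def less_mult_imp_div_less mat_of_cols_def)
qed

lemma dim_kron_vec: "dim_vec (kron_vec a y) = dim_vec a * dim_vec y"
  by (simp add: kron_vec_def kron_def col_mat_def)

text \<open>The mixed-product rule with \<open>y\<close> as a trivial Kronecker product.
  \<open>B\<close> will be the identity on the left of the ansatz equation and \<open>P(lam)\<close>
  on the right.\<close>

lemma kron_col_mult_vec:
  assumes B: "B \<in> carrier_mat n n" and y: "y \<in> carrier_vec n"
  shows "kron (col_mat a) B *\<^sub>v y = kron_vec a (B *\<^sub>v y)"
proof (rule eq_vecI)
  fix i assume "i < dim_vec (kron_vec a (B *\<^sub>v y))"
  then have i: "i < dim_vec a * n"
    using B by (simp add: dim_kron_vec)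
  then have n: "0 < n"
    by (cases n) auto
  have "(kron (col_mat a) B *\<^sub>v y) $ i = (\<Sum>j<n. a $ (i div n) * B $$ (i mod n, j) * y $ j)"
    using i B y n
    by (simp add: kron_def col_mat_def scalar_prod_def lessThan_atLeast0 mat_of_cols_def less_mult_imp_div_less)
  also have "\<dots> = a $ (i div n) * (B *\<^sub>v y) $ (i mod n)"
    using n B y by (simp add: scalar_prod_def lessThan_atLeast0 sum_distrib_left mult.assoc)
  also have "\<dots> = kron_vec a (B *\<^sub>v y) $ i"
    using kron_vec_index[of i a "B *\<^sub>v y"] i B by simp
  finally show "(kron (col_mat a) B *\<^sub>v y) $ i = kron_vec a (B *\<^sub>v y) $ i" .
qed (use B in \<open>simp add: dim_kron_vec\<close>, simp add: kron_def col_mat_def)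

text \<open>The indices are grouped into blocks of length \<open>n\<close>: on a block the quotient
  is constant and the remainder runs once through all values.\<close>

lemma sum_div_mod:
  fixes f g :: "nat \<Rightarrow> 'a::comm_semiring_0"
  shows "(\<Sum>i<m * n. f (i div n) * g (i mod n)) = (\<Sum>i<m. f i) * (\<Sum>j<n. g j)"
proof -
  have "(\<Sum>i<m * n. f (i div n) * g (i mod n)) = (\<Sum>i<m. \<Sum>k\<in>{i * n..<i * n + n}. f (k div n) * g (k mod n))"
    by (rule sum.nat_group[symmetric])
  also have "\<dots> = (\<Sum>i<m. \<Sum>j<n. f i * g j)"
  proof (rule sum.cong[OF refl])
    fix i
    have "(\<Sum>k\<in>{i * n..<i * n + n}. f (k div n) * g (k mod n))
        = (\<Sum>j\<in>{0..<n}. f ((j + i * n) div n) * g ((j + i * n) mod n))"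
      using sum.shift_bounds_nat_ivl[of "\<lambda>k. f (k div n) * g (k mod n)" 0 "i * n" n] by (simp add: add.commute)
    also have "\<dots> = (\<Sum>j<n. f i * g j)"
      by (intro sum.cong) auto
    finally show "(\<Sum>k\<in>{i * n..<i * n + n}. f (k div n) * g (k mod n)) = (\<Sum>j<n. f i * g j)" .
  qed
  finally show ?thesis
    by (simp add: sum_product)
qed

lemma cscalar_prod_kron_vec:
  fixes a a' y y' :: "complex vec"
  assumes "dim_vec a = dim_vec a'" "dim_vec y = dim_vec y'"
  shows "kron_vec a y \<bullet>c kron_vec a' y' = (a \<bullet>c a') * (y \<bullet>c y')"
proof -
  let ?m = "dim_vec a'" and ?n = "dim_vec y'"
  have "kron_vec a y \<bullet>c kron_vec a' y'
      = (\<Sum>i<?m * ?n. (a $ (i div ?n) * cnj (a' $ (i div ?n))) * (y $ (i mod ?n) * cnj (y' $ (i mod ?n))))"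
    unfolding cscalar_prod_sum dim_kron_vec
    using assms by (intro sum.cong) (simp_all add: kron_vec_index)
  also have "\<dots> = (a \<bullet>c a') * (y \<bullet>c y')"
    unfolding cscalar_prod_sum by (rule sum_div_mod)
  finally show ?thesis .
qed

lemma norm2_kron_vec: "norm2 (kron_vec a y) = norm2 a * norm2 y"
proof -
  have "complex_of_real ((norm2 (kron_vec a y))\<^sup>2) = complex_of_real ((norm2 a * norm2 y)\<^sup>2)"
    using cscalar_prod_kron_vec[of a a y y] by (simp only: cscalar_prod_self power_mult_distrib of_real_mult)
  then show ?thesis
    unfolding of_real_eq_iff by (simp add: norm2_nonneg)
qed

section \<open>Norms of vectors of powers\<close>

text \<open>\<open>Lam\<close> lists the powers in descending order, so the sum is reversed. With
  \<open>1 \<le> m\<close> the top index is \<open>m - 1\<close>, which makes this the quantity that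
  divides backward errors at grade \<open>m - 1\<close>.\<close>

lemma norm2_Lam:
  assumes "1 \<le> m"
  shows "norm2 (Lam m z) = L2_set (\<lambda>j. cmod z ^ j) {..m - 1}"
proof -
  have "(\<Sum>i<m. (cmod z ^ (m - Suc i))\<^sup>2) = (\<Sum>i<m. (cmod z ^ i)\<^sup>2)"
    by (rule sum.nat_diff_reindex)
  moreover have "{..m - 1} = {..<m}"
    using assms by auto
  ultimately show ?thesis
    by (simp add: norm2_def Lam_def L2_set_def norm_power)
qed

text \<open>The factors \<open>1 - t ^ j\<close> and \<open>1 - t ^ (m - j)\<close> never have
  opposite signs; expanding their nonnegative product gives the claim.\<close>

lemma pow_add_pow_le:
  fixes t :: real
  assumes "0 \<le> t" "j \<le> m"
  shows "t ^ j + t ^ (m - j) \<le> 1 + t ^ m"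
proof -
  have "t ^ m = t ^ j * t ^ (m - j)"
    using assms by (simp flip: power_add)
  moreover have "0 \<le> (1 - t ^ j) * (1 - t ^ (m - j))"
    using assms by (cases "t \<le> 1")
      (auto simp: power_le_one one_le_power intro: mult_nonneg_nonneg mult_nonpos_nonpos)
  ultimately show ?thesis
    by (simp add: algebra_simps)
qed

text \<open>With \<open>C\<close> the sum of the inner powers, \<open>A\<close> is
  \<open>1 + C + t ^ m\<close> and \<open>B\<close> is \<open>1 + 2 * C + t ^ m\<close>. The second
  bound amounts to \<open>2 * C \<le> (m - 1) * (1 + t ^ m)\<close>, which follows by pairing
  \<open>t ^ j\<close> with \<open>t ^ (m - j)\<close>. At \<open>t = 1\<close> there is equality,
  whence the constant.\<close>

lemma geometric_sum_bounds:
  fixes t :: real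
  assumes t: "0 \<le> t" and m: "1 \<le> m"
  defines "A \<equiv> \<Sum>j\<le>m. t ^ j" and "B \<equiv> (1 + t) * (\<Sum>j\<le>m - 1. t ^ j)"
  shows "A \<le> B" and "(real m + 1) * B \<le> 2 * real m * A"
proof -
  let ?C = "\<Sum>j\<in>{1..<m}. t ^ j"
  have A: "A = 1 + ?C + t ^ m"
  proof -
    have "{..m} = insert 0 (insert m {1..<m})" using m by auto
    then show ?thesis using m by (simp add: A_def)
  qed
  have "{..m - 1} = insert 0 {1..<m}" using m by auto
  then have s1: "(\<Sum>j\<le>m - 1. t ^ j) = 1 + ?C" by simp
  have "t * (\<Sum>j\<le>m - 1. t ^ j) = (\<Sum>j\<in>{1..m}. t ^ j)"
  proof -
    have "t * (\<Sum>j\<le>m - 1. t ^ j) = (\<Sum>j\<le>m - 1. t ^ Suc j)"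
      by (simp add: sum_distrib_left)
    also have "\<dots> = (\<Sum>j\<in>{1..m}. t ^ j)"
      using sum.shift_bounds_cl_Suc_ivl[of "\<lambda>j. t ^ j" 0 "m - 1"] m by (simp add: atLeast0AtMost)
    finally show ?thesis .
  qed
  also have "{1..m} = insert m {1..<m}" using m by auto
  finally have s2: "t * (\<Sum>j\<le>m - 1. t ^ j) = ?C + t ^ m" by simp
  have B: "B = 1 + 2 * ?C + t ^ m"
    using s1 s2 by (simp add: B_def algebra_simps)
  have C: "0 \<le> ?C"
    using t by (simp add: sum_nonneg)
  then show "A \<le> B"
    by (simp add: A B)
  have "?C = (\<Sum>j\<in>{1..<m}. t ^ (m - j))"
    by (rule sum.reindex_bij_witness[of _ "\<lambda>j. m - j" "\<lambda>j. m - j"]) auto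
  then have "2 * ?C = (\<Sum>j\<in>{1..<m}. t ^ j) + (\<Sum>j\<in>{1..<m}. t ^ (m - j))"
    by linarith
  also have "\<dots> \<le> (\<Sum>j\<in>{1..<m}. 1 + t ^ m)"
    unfolding sum.distrib[symmetric] using t by (intro sum_mono pow_add_pow_le) auto
  also have "\<dots> = (real m - 1) * (1 + t ^ m)"
    using m by (simp add: of_nat_diff)
  finally show "(real m + 1) * B \<le> 2 * real m * A"
    by (simp add: A B algebra_simps)
qed

text \<open>Squaring and putting \<open>t = (cmod z)\<^sup>2\<close> turns the three norms into
  geometric sums and the ratio into \<open>A / B\<close>.\<close>

lemma Lam_norm_ratio_bounds:
  fixes z :: complex
  assumes m: "1 \<le> m"
  defines "l \<equiv> \<lambda>k. L2_set (\<lambda>j. cmod z ^ j) {..k}"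
  shows "sqrt ((real m + 1) / (2 * real m)) \<le> l m / (l (m - 1) * l 1)"
    and "l m / (l (m - 1) * l 1) \<le> 1"
proof -
  define t where "t = (cmod z)\<^sup>2"
  have l: "l k = sqrt (\<Sum>j\<le>k. t ^ j)" for k
    by (simp add: l_def L2_set_def t_def power_mult[symmetric] mult.commute)
  define A where "A = (\<Sum>j\<le>m. t ^ j)"
  define B where "B = (1 + t) * (\<Sum>j\<le>m - 1. t ^ j)"
  have t: "0 \<le> t" by (simp add: t_def)
  have "1 \<le> (\<Sum>j\<le>m - 1. t ^ j)"
    using member_le_sum[of 0 "{..m - 1}" "\<lambda>j. t ^ j"] t by simp
  then have B: "0 < B"
    using t by (simp add: B_def)
  have eq: "l m / (l (m - 1) * l 1) = sqrt (A / B)"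
    by (simp add: l A_def B_def real_sqrt_divide real_sqrt_mult mult.commute)
  show "l m / (l (m - 1) * l 1) \<le> 1"
    unfolding eq using geometric_sum_bounds(1)[OF t m] B by (simp add: A_def B_def)
  show "sqrt ((real m + 1) / (2 * real m)) \<le> l m / (l (m - 1) * l 1)"
    unfolding eq using geometric_sum_bounds(2)[OF t m, folded A_def B_def] B m
    by (simp add: pos_le_divide_eq pos_divide_le_eq mult.commute)
qed

section \<open>Comparison of the backward errors of the pencil and the polynomial\<close>

theorem theorem4p10:
  fixes m n :: nat and P L :: mat_poly and lam :: complex and x v :: "complex vec"
    and T S :: "nat \<Rightarrow> nat \<Rightarrow> mat_poly set"
  assumes "m \<ge> 1" and "n \<ge> 1"
    and "T \<in> {H_even, H_odd}" and "P \<in> T m n" and "regular P"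
    and "x \<in> carrier_vec n" and "norm2 x = 1" and "mp_eval P lam *\<^sub>v x \<noteq> 0\<^sub>v n"
    and "S \<in> {H_even, H_odd}" and "L \<in> S 1 (m * n)"
    and "L \<in> L1_space m n P" and "linearization m n P L"
    and "right_ansatz_vector m n P L v" and "norm2 v = 1"
    and "Re lam = 0"
  shows
    "sqrt ((real m + 1) / (2 * real m))
       \<le> backward_error frobenius_norm 1 (S 1 (m * n)) lam (kron_vec (Lam m lam) x) L
          / backward_error frobenius_norm m (T m n) lam x P
     \<and> backward_error frobenius_norm 1 (S 1 (m * n)) lam (kron_vec (Lam m lam) x) L
          / backward_error frobenius_norm m (T m n) lam x P
       \<le> sqrt 2
     \<and> sqrt ((real m + 1) / (2 * real m))
       \<le> backward_error spectral_norm 1 (S 1 (m * n)) lam (kron_vec (Lam m lam) x) L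
          / backward_error spectral_norm m (T m n) lam x P
     \<and> backward_error spectral_norm 1 (S 1 (m * n)) lam (kron_vec (Lam m lam) x) L
          / backward_error spectral_norm m (T m n) lam x P
       \<le> 1"
proof -
  \<comment> \<open>The structures of \<open>P\<close> and \<open>L\<close> receive separate phases
    \<open>c\<close> and \<open>d\<close>. The formulas for the backward errors do not depend on
    them, so all four combinations are handled together.\<close>
  have phase: "\<exists>c. cmod c = 1 \<and> (\<forall>k N. U k N = phase_class c k N)"
    if "U \<in> {H_even, H_odd}" for U :: "nat \<Rightarrow> nat \<Rightarrow> mat_poly set"
    using that H_even_phase_class H_odd_phase_class by (metis insertE norm_ii norm_one singletonD)
  obtain c where c: "cmod c = 1" "\<And>k N. T k N = phase_class c k N"
    using phase[OF assms(3)] by blast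
  obtain d where d: "cmod d = 1" "\<And>k N. S k N = phase_class d k N"
    using phase[OF assms(9)] by blast
  have P: "P \<in> phase_class c m n" and L: "L \<in> phase_class d 1 (m * n)"
    using assms(4,10) by (simp_all add: c d)
  have Pc: "mp_eval P lam \<in> carrier_mat n n" and Lc: "mp_eval L lam \<in> carrier_mat (m * n) (m * n)"
    using P L mp_eval_carrier unfolding phase_class_def by blast+
  note x = \<open>x \<in> carrier_vec n\<close> \<open>norm2 x = 1\<close>
  define l where "l k = L2_set (\<lambda>j. cmod lam ^ j) {..k}" for k :: nat
  have l: "0 < l k" for k
  proof -
    have "cmod lam ^ 0 \<le> l k"
      unfolding l_def by (rule member_le_L2_set) simp_all
    then show ?thesis
      by simp
  qed
  let ?\<Lambda> = "Lam m lam" and ?u = "kron_vec (Lam m lam) x"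
  have dim_Lam: "dim_vec ?\<Lambda> = m"
    by (simp add: Lam_def)
  have norm_Lam: "norm2 ?\<Lambda> = l (m - 1)"
    unfolding l_def by (rule norm2_Lam[OF assms(1)])
  have u: "?u \<in> carrier_vec (m * n)" "norm2 ?u = l (m - 1)"
    by (simp_all only: dim_kron_vec dim_Lam carrier_vecD[OF x(1)] norm2_kron_vec norm_Lam x(2) mult_1_right
        carrier_dim_vec)
  define b where "b = mp_eval P lam *\<^sub>v x"
  have b: "b \<in> carrier_vec n"
    unfolding b_def using Pc x(1) by (rule mult_mat_vec_carrier)
  define \<beta> where "\<beta> = norm2 b"
  have \<beta>: "0 < \<beta>"
    using assms(8) norm2_eq_0_iff[OF b] norm2_nonneg[of b] by (auto simp: \<beta>_def b_def less_le)
  have v: "v \<in> carrier_vec m"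
    and ansatz: "mp_eval L lam * kron (col_mat ?\<Lambda>) (1\<^sub>m n) = kron (col_mat v) (mp_eval P lam)"
    using assms(13) by (auto simp: right_ansatz_vector_def)
  have kron1: "kron (col_mat ?\<Lambda>) (1\<^sub>m n) \<in> carrier_mat (m * n) n"
    by (rule carrier_matI) (simp_all add: kron_def col_mat_def dim_Lam)
  \<comment> \<open>The vector is rewritten as the Kronecker matrix of the ansatz equation applied
    to \<open>x\<close>, so that the equation can be used at \<open>lam\<close>.\<close>
  have "mp_eval L lam *\<^sub>v ?u = mp_eval L lam *\<^sub>v (kron (col_mat ?\<Lambda>) (1\<^sub>m n) *\<^sub>v x)"
    using x by (simp add: kron_col_mult_vec[of _ n])
  also have "\<dots> = kron (col_mat v) (mp_eval P lam) *\<^sub>v x"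
    using assoc_mult_mat_vec[OF Lc kron1 x(1)] by (simp add: ansatz)
  also have "\<dots> = kron_vec v b"
    unfolding b_def by (rule kron_col_mult_vec[OF Pc x(1)])
  finally have Lu: "mp_eval L lam *\<^sub>v ?u = kron_vec v b" .
  have norm_Lu: "norm2 (kron_vec v b) = \<beta>"
    by (simp add: norm2_kron_vec \<beta>_def \<open>norm2 v = 1\<close>)
  have inner: "cmod (kron_vec v b \<bullet>c ?u) \<le> l (m - 1) * cmod (b \<bullet>c x)"
  proof -
    have "cmod (kron_vec v b \<bullet>c ?u) = cmod (v \<bullet>c ?\<Lambda>) * cmod (b \<bullet>c x)"
      using v b x by (simp add: cscalar_prod_kron_vec dim_Lam norm_mult)
    also have "cmod (v \<bullet>c ?\<Lambda>) \<le> l (m - 1)"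
      using cscalar_prod_Cauchy_Schwarz[of v ?\<Lambda>] v by (simp add: dim_Lam norm_Lam \<open>norm2 v = 1\<close>)
    finally show ?thesis
      by (simp add: mult_right_mono)
  qed
  have mn: "0 < m * n" "0 < n"
    using assms(1,2) by simp_all
  \<comment> \<open>\<open>p\<close> and \<open>q\<close> are the inner-product terms that lower the
    two Frobenius errors. Dividing by the norm \<open>l (m - 1)\<close> of the pencil vector brings
    \<open>q\<close> to the scale of \<open>p\<close>, so that
    \<open>q \<le> p \<le> \<beta>\<close>.\<close>
  define p where "p = cmod (b \<bullet>c x)"
  define q where "q = cmod (kron_vec v b \<bullet>c ?u) / l (m - 1)"
  have p: "0 \<le> p" "p \<le> \<beta>"
    using cscalar_prod_Cauchy_Schwarz[of b x] b x by (simp_all add: p_def \<beta>_def)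
  have q: "0 \<le> q" "q \<le> p"
    using inner l[of "m - 1"] by (simp_all add: q_def p_def divide_le_eq mult.commute)
  have p2: "p\<^sup>2 \<le> \<beta>\<^sup>2" and q2: "q\<^sup>2 \<le> p\<^sup>2" and \<beta>2: "0 < \<beta>\<^sup>2"
    using p q \<beta> by (simp_all add: power_mono)
  have ux: "norm2 x \<noteq> 0" "norm2 ?u \<noteq> 0"
    using l[of "m - 1"] by (simp_all add: x u)
  note Pform = backward_error_formulas[OF c(1) assms(15) P x(1) ux(1) mn(2), folded c(2) b_def l_def]
  note Lform = backward_error_formulas[OF d(1) assms(15) L u(1) ux(2) mn(1), unfolded Lu, folded d(2) l_def]
  define R where "R = l m / (l (m - 1) * l 1)"
  have R: "sqrt ((real m + 1) / (2 * real m)) \<le> R" "R \<le> 1" "0 \<le> R"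
    using Lam_norm_ratio_bounds[OF assms(1), of lam] l by (simp_all add: R_def l_def[symmetric] less_imp_le)
  have spectral: "backward_error spectral_norm 1 (S 1 (m * n)) lam ?u L
      / backward_error spectral_norm m (T m n) lam x P = R"
    unfolding Pform(1) Lform(1) norm_Lu u(2) x(2) \<beta>_def[symmetric] using \<beta> by (simp add: R_def)
  have "2 * (\<beta> / l (m - 1))\<^sup>2 - (cmod (kron_vec v b \<bullet>c ?u) / (l (m - 1))\<^sup>2)\<^sup>2
      = (2 * \<beta>\<^sup>2 - q\<^sup>2) / (l (m - 1))\<^sup>2"
    by (simp add: q_def power_divide diff_divide_distrib power2_eq_square)
  then have "backward_error frobenius_norm 1 (S 1 (m * n)) lam ?u L = sqrt (2 * \<beta>\<^sup>2 - q\<^sup>2) / (l (m - 1) * l 1)"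
    unfolding Lform(2) norm_Lu u(2) using l[of "m - 1"] by (simp add: real_sqrt_divide)
  moreover have "backward_error frobenius_norm m (T m n) lam x P = sqrt (2 * \<beta>\<^sup>2 - p\<^sup>2) / l m"
    unfolding Pform(2) x(2) by (simp add: p_def \<beta>_def)
  ultimately have frob: "backward_error frobenius_norm 1 (S 1 (m * n)) lam ?u L
      / backward_error frobenius_norm m (T m n) lam x P = sqrt ((2 * \<beta>\<^sup>2 - q\<^sup>2) / (2 * \<beta>\<^sup>2 - p\<^sup>2)) * R"
    by (simp add: R_def real_sqrt_divide)
  \<comment> \<open>The quotient under the root is at least 1 because \<open>q \<le> p\<close>. It
    is at most 2 because the numerator is at most \<open>2 * \<beta>\<^sup>2\<close> and the
    denominator at least \<open>\<beta>\<^sup>2\<close>.\<close>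
  have pos: "0 < 2 * \<beta>\<^sup>2 - p\<^sup>2"
    using p2 \<beta>2 by linarith
  have "1 \<le> (2 * \<beta>\<^sup>2 - q\<^sup>2) / (2 * \<beta>\<^sup>2 - p\<^sup>2)"
    using q2 by (simp add: pos_le_divide_eq[OF pos])
  then have "1 \<le> sqrt ((2 * \<beta>\<^sup>2 - q\<^sup>2) / (2 * \<beta>\<^sup>2 - p\<^sup>2))"
    by simp
  moreover have "(2 * \<beta>\<^sup>2 - q\<^sup>2) / (2 * \<beta>\<^sup>2 - p\<^sup>2) \<le> 2"
    unfolding pos_divide_le_eq[OF pos] right_diff_distrib using p2 zero_le_power2[of q] by linarith
  then have "sqrt ((2 * \<beta>\<^sup>2 - q\<^sup>2) / (2 * \<beta>\<^sup>2 - p\<^sup>2)) \<le> sqrt 2"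
    by simp
  ultimately have "R \<le> sqrt ((2 * \<beta>\<^sup>2 - q\<^sup>2) / (2 * \<beta>\<^sup>2 - p\<^sup>2)) * R"
    and "sqrt ((2 * \<beta>\<^sup>2 - q\<^sup>2) / (2 * \<beta>\<^sup>2 - p\<^sup>2)) * R \<le> sqrt 2"
    using R mult_right_mono[of 1 _ R] mult_mono[of "sqrt ((2 * \<beta>\<^sup>2 - q\<^sup>2) / (2 * \<beta>\<^sup>2 - p\<^sup>2))" "sqrt 2" R 1]
    by simp_all
  then show ?thesis
    unfolding spectral frob using R by linarith
qed

end
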